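(* Let $\mathbf h^k$ be a feasible path flow vector, let $\mathbf p^k=\mathcal{P}(\mathcal{C}(\mathbf h^k))$ and $\mathcal{F}(\mathbf h^k)=\mathcal{L}(\mathbf h^k)-\mathbf h^k$. The reduced Newton system $$(\mathbf I-\mathcal{K}(\mathbf h^k))\,\boldsymbol\delta^k=\mathcal{F}(\mathbf h^k)$$ has a unique solution $\boldsymbol\delta^k\in\mathbb{R}^n$. Moreover, $\boldsymbol\delta^k$ is the only element of the solution set of the full Newton system $$\bigl(\mathcal{H}'_{\mathbf h}(\mathbf p^k)+\mathcal{K}(\mathbf h^k)-\mathbf I\bigr)\,\boldsymbol{\hat\delta}^k=-\mathcal{F}(\mathbf h^k)$$ that preserves demand, i.e. that satisfies $\sum_{i\in\mathbb{P}_{OD}}\delta^k_i=0$ for every OD pair.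
   Context: Network setting. There is a finite set $\mathbb{L}$ of links and a finite nonempty set of origin-destination (OD) pairs. Each OD pair has a demand $d_{OD}\ge 0$ and a fixed finite nonempty set $\mathbb{P}_{OD}$ of acyclic paths; $\mathbb{P}$ is the disjoint union of the $\mathbb{P}_{OD}$, $n=|\mathbb{P}|$, and $OD(i)$ is the OD pair of path $i$. $\mathbf{D}\in\{0,1\}^{|\mathbb{L}|\times n}$ is the link-path incidence matrix ($D_{li}=1$ iff link $l$ is on path $i$). A vector $\mathbf{h}\in\mathbb{R}^n$ is a feasible path flow vector if $h_i\ge 0$ for all $i$ and $\sum_{i\in\mathbb{P}_{OD}}h_i=d_{OD}$ for every OD pair. Costs. The cost of link $l$ depends only on its own flow $a_l$ via $\tau_l:[0,\infty)\to[0,\infty)$, which is twice continuously differentiable and monotone non-decreasing, with $\tau_l'$ Lipschitz on the bounded set of link flows arising from feasible path flows. Link flows are $\mathbf a=\mathbf D\mathbf h$, path costs are $\mathcal{C}(\mathbf h)=\mathbf{D}^T\mathcal{T}(\mathbf{D}\mathbf{h})$ with $\mathcal{T}_l(\mathbf a)=\tau_l(a_l)$, and the Jacobian is $\mathcal{C}'(\mathbf h)=\mathbf D^T\operatorname{diag}(\tau_l'(a_l))\mathbf D$. Logit model. $\theta>0$ is a fixed parameter. For a path cost vector $\mathbf c$, $\mathcal{P}(\mathbf c)_i=\exp(-\theta c_i)/\sum_{i'\in\mathbb{P}_{OD(i)}}\exp(-\theta c_{i'})$. Put $\mathcal{H}(\mathbf h,\mathbf p)_i=\bigl(\sum_{i'\in\mathbb{P}_{OD(i)}}h_{i'}\bigr)p_i$.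 The logit mapping is $\mathcal{L}(\mathbf h)=\mathcal{H}(\mathbf h,\mathcal{P}(\mathcal{C}(\mathbf h)))$. $\mathcal{P}'(\mathbf c)$ is the Jacobian of $\mathcal{P}$; $\mathcal{H}'_{\mathbf h}(\mathbf p)$ is the Jacobian of $\mathcal{H}$ in $\mathbf h$ with $\mathbf p$ fixed (its $(i,j)$ entry is $p_i$ if $i,j$ belong to the same OD pair and $0$ otherwise); $\mathcal{H}'_{\mathbf p}(\mathbf h)$ is the Jacobian of $\mathcal{H}$ in $\mathbf p$ with $\mathbf h$ fixed (for feasible $\mathbf h$, the diagonal matrix with entries $d_{OD(i)}$). The reduced Jacobian is $\mathcal{K}(\mathbf h)=\mathcal{H}'_{\mathbf p}(\mathbf h)\,\mathcal{P}'(\mathbf c)\,\mathcal{C}'(\mathbf h)$ with $\mathbf c=\mathcal{C}(\mathbf h)$. *)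

theory Defs
  imports "HOL-Analysis.Analysis" "Graph_Theory.Arc_Walk"
begin

text \<open>
  Paths are indexed by \<open>'p\<close>, OD pairs by \<open>'w\<close> and links by \<open>'l\<close>. The map \<open>od\<close> sends a path to its
  OD pair, so the set of paths of \<open>w\<close> is \<open>{i. od i = w}\<close>; \<open>route i\<close> lists the links of path \<open>i\<close>.
\<close>

definition incidence :: "('p::finite \<Rightarrow> 'l::finite list) \<Rightarrow> real^'p^'l" where
  "incidence route = (\<chi> l i. if l \<in> set (route i) then 1 else 0)"

definition feasible_flows :: "('p::finite \<Rightarrow> 'w) \<Rightarrow> ('w \<Rightarrow> real) \<Rightarrow> (real^'p) set" where
  "feasible_flows od d =
     {h. (\<forall>i. 0 \<le> h $ i) \<and> (\<forall>w. (\<Sum>i | od i = w. h $ i) = d w)}"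

text \<open>
  Link cost functions live on \<open>[0,\<infinity>)\<close>; all derivatives are taken within that set, hence one-sided
  at zero flow.
\<close>

definition twice_cont_diff_nonneg :: "(real \<Rightarrow> real) \<Rightarrow> bool" where
  "twice_cont_diff_nonneg f \<longleftrightarrow>
     (\<exists>f' f''. (\<forall>x\<ge>0. (f has_real_derivative f' x) (at x within {0..})) \<and>
               (\<forall>x\<ge>0. (f' has_real_derivative f'' x) (at x within {0..})) \<and>
               continuous_on {0..} f'')"

definition deriv_nonneg :: "(real \<Rightarrow> real) \<Rightarrow> real \<Rightarrow> real" where
  "deriv_nonneg f x = vector_derivative f (at x within {0..})"

definition link_costs :: "('l::finite \<Rightarrow> real \<Rightarrow> real) \<Rightarrow> real^'l \<Rightarrow> real^'l" where
  "link_costs \<tau> a = (\<chi> l. \<tau> l (a $ l))"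

definition link_costs_jacobian :: "('l::finite \<Rightarrow> real \<Rightarrow> real) \<Rightarrow> real^'l \<Rightarrow> real^'l^'l" where
  "link_costs_jacobian \<tau> a = (\<chi> l m. if l = m then deriv_nonneg (\<tau> l) (a $ l) else 0)"

definition path_costs ::
  "('p::finite \<Rightarrow> 'l::finite list) \<Rightarrow> ('l \<Rightarrow> real \<Rightarrow> real) \<Rightarrow> real^'p \<Rightarrow> real^'p" where
  "path_costs route \<tau> h =
     transpose (incidence route) *v link_costs \<tau> (incidence route *v h)"

definition path_costs_jacobian ::
  "('p::finite \<Rightarrow> 'l::finite list) \<Rightarrow> ('l \<Rightarrow> real \<Rightarrow> real) \<Rightarrow> real^'p \<Rightarrow> real^'p^'p" where
  "path_costs_jacobian route \<tau> h =
     transpose (incidence route) ** link_costs_jacobian \<tau> (incidence route *v h) ** incidence route"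

definition logit_prob :: "('p::finite \<Rightarrow> 'w) \<Rightarrow> real \<Rightarrow> real^'p \<Rightarrow> real^'p" where
  "logit_prob od \<theta> c =
     (\<chi> i. exp (- \<theta> * c $ i) / (\<Sum>j | od j = od i. exp (- \<theta> * c $ j)))"

definition assign_flow :: "('p::finite \<Rightarrow> 'w) \<Rightarrow> real^'p \<Rightarrow> real^'p \<Rightarrow> real^'p" where
  "assign_flow od h p = (\<chi> i. (\<Sum>j | od j = od i. h $ j) * p $ i)"

definition path_probs ::
  "('p::finite \<Rightarrow> 'w) \<Rightarrow> ('p \<Rightarrow> 'l::finite list) \<Rightarrow> ('l \<Rightarrow> real \<Rightarrow> real) \<Rightarrow> real \<Rightarrow> real^'p \<Rightarrow> real^'p" where
  "path_probs od route \<tau> \<theta> h = logit_prob od \<theta> (path_costs route \<tau> h)"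

definition logit_map ::
  "('p::finite \<Rightarrow> 'w) \<Rightarrow> ('p \<Rightarrow> 'l::finite list) \<Rightarrow> ('l \<Rightarrow> real \<Rightarrow> real) \<Rightarrow> real \<Rightarrow> real^'p \<Rightarrow> real^'p" where
  "logit_map od route \<tau> \<theta> h = assign_flow od h (path_probs od route \<tau> \<theta> h)"

definition residual ::
  "('p::finite \<Rightarrow> 'w) \<Rightarrow> ('p \<Rightarrow> 'l::finite list) \<Rightarrow> ('l \<Rightarrow> real \<Rightarrow> real) \<Rightarrow> real \<Rightarrow> real^'p \<Rightarrow> real^'p" where
  "residual od route \<tau> \<theta> h = logit_map od route \<tau> \<theta> h - h"

definition assign_jacobian_flow :: "('p::finite \<Rightarrow> 'w) \<Rightarrow> real^'p \<Rightarrow> real^'p \<Rightarrow> real^'p^'p" where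
  "assign_jacobian_flow od h p = jacobian (\<lambda>h'. assign_flow od h' p) (at h)"

definition assign_jacobian_prob :: "('p::finite \<Rightarrow> 'w) \<Rightarrow> real^'p \<Rightarrow> real^'p \<Rightarrow> real^'p^'p" where
  "assign_jacobian_prob od h p = jacobian (\<lambda>p'. assign_flow od h p') (at p)"

definition reduced_jacobian ::
  "('p::finite \<Rightarrow> 'w) \<Rightarrow> ('p \<Rightarrow> 'l::finite list) \<Rightarrow> ('l \<Rightarrow> real \<Rightarrow> real) \<Rightarrow> real \<Rightarrow> real^'p \<Rightarrow> real^'p^'p" where
  "reduced_jacobian od route \<tau> \<theta> h =
     assign_jacobian_prob od h (path_probs od route \<tau> \<theta> h)
     ** jacobian (logit_prob od \<theta>) (at (path_costs route \<tau> h))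
     ** path_costs_jacobian route \<tau> h"

text \<open>
  The links of the network are the arcs of \<open>G\<close>, which may be any subset of the finite type \<open>'l\<close>, even
  the empty one. Elements of \<open>'l\<close> that are not arcs lie on no path: they only add zero rows to the
  incidence matrix, and their (unconstrained) cost functions do not affect any path cost. The two
  injectivity assumptions say that \<open>'w\<close> and \<open>'p\<close> index sets (rather than families) of OD pairs and
  of paths per OD pair.
\<close>

locale logit_network = wf_digraph G
  for G :: "('v, 'l::finite) pre_digraph" +
  fixes origin dest :: "'w::finite \<Rightarrow> 'v"
    and od :: "'p::finite \<Rightarrow> 'w"
    and route :: "'p \<Rightarrow> 'l list"
    and d :: "'w \<Rightarrow> real"
    and \<tau> :: "'l \<Rightarrow> real \<Rightarrow> real"
    and \<theta> :: real
  assumes inj_ends: "inj (\<lambda>w. (origin w, dest w))"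
    and surj_od: "surj od"
    and inj_route: "inj (\<lambda>i. (od i, route i))"
    and acyclic_path: "apath (origin (od i)) (route i) (dest (od i))"
    and demand_nonneg: "0 \<le> d w"
    and cost_nonneg: "\<lbrakk>l \<in> arcs G; 0 \<le> x\<rbrakk> \<Longrightarrow> 0 \<le> \<tau> l x"
    and cost_smooth: "l \<in> arcs G \<Longrightarrow> twice_cont_diff_nonneg (\<tau> l)"
    and cost_mono: "l \<in> arcs G \<Longrightarrow> mono_on {0..} (\<tau> l)"
    and cost_deriv_lipschitz: "l \<in> arcs G \<Longrightarrow>
      \<exists>C. C-lipschitz_on ((\<lambda>h. (incidence route *v h) $ l) ` feasible_flows od d) (deriv_nonneg (\<tau> l))"
    and theta_pos: "0 < \<theta>"

lemma deriv_nonneg_works: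
  assumes "twice_cont_diff_nonneg f" "0 \<le> x"
  shows "(f has_real_derivative deriv_nonneg f x) (at x within {0..})"
proof -
  obtain f' where f': "(f has_real_derivative f') (at x within {0..})"
    using assms unfolding twice_cont_diff_nonneg_def by blast
  then have "(f has_vector_derivative f') (at x within {0..})"
    by (simp add: has_real_derivative_iff_has_vector_derivative)
  moreover have "at x within {0..} \<noteq> bot"
  proof -
    have "at x within {x..} \<noteq> bot"
      using at_within_Ici_at_right[of x] by simp
    moreover have "at x within {x..} \<le> at x within {0..}"
      using assms(2) by (intro at_le) auto
    ultimately show ?thesis by (auto simp: le_bot)
  qed
  ultimately show ?thesis
    using f' unfolding deriv_nonneg_def by (simp add: vector_derivative_within)
qed

lemma assign_jacobian_flow_entry:
  fixes od :: "'p::finite \<Rightarrow> 'w"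
  shows "assign_jacobian_flow od h p $ i $ j = (if od i = od j then p $ i else 0)"
proof -
  define A :: "real^'p^'p" where "A = (\<chi> i j. if od i = od j then p $ i else 0)"
  have "(assign_flow od x p) $ k = (A *v x) $ k" for x k
  proof -
    have "(A *v x) $ k = (\<Sum>j\<in>UNIV. if od j = od k then x $ j * p $ k else 0)"
      unfolding A_def matrix_vector_mult_def by (simp only: vec_lambda_beta) (rule sum.cong, auto)
    also have "\<dots> = (\<Sum>j | od j = od k. x $ j * p $ k)"
      by (simp add: sum.inter_filter[symmetric])
    finally show ?thesis by (simp add: assign_flow_def sum_distrib_right)
  qed
  then have eq: "(\<lambda>x. assign_flow od x p) = (*v) A" by (simp add: vec_eq_iff fun_eq_iff)
  have "frechet_derivative ((*v) A) (at h) = (*v) A"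
    by (rule frechet_derivative_at[symmetric]) (rule bounded_linear_imp_has_derivative[OF matrix_vector_mul_bounded_linear])
  then show ?thesis
    unfolding assign_jacobian_flow_def jacobian_def eq by (simp add: A_def)
qed

lemma assign_jacobian_prob_entry:
  fixes od :: "'p::finite \<Rightarrow> 'w"
  assumes "h \<in> feasible_flows od d"
  shows "assign_jacobian_prob od h p $ i $ j = (if i = j then d (od i) else 0)"
proof -
  define A :: "real^'p^'p" where "A = (\<chi> i j. if i = j then d (od i) else 0)"
  have "(assign_flow od h x) $ k = (A *v x) $ k" for x k
  proof -
    have "(A *v x) $ k = (\<Sum>j\<in>UNIV. if j = k then d (od k) * x $ j else 0)"
      unfolding A_def matrix_vector_mult_def by (simp only: vec_lambda_beta) (rule sum.cong, auto)
    then show ?thesis using assms by (simp add: assign_flow_def feasible_flows_def)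
  qed
  then have eq: "assign_flow od h = (*v) A" by (simp add: vec_eq_iff fun_eq_iff)
  have "frechet_derivative ((*v) A) (at p) = (*v) A"
    by (rule frechet_derivative_at[symmetric]) (rule bounded_linear_imp_has_derivative[OF matrix_vector_mul_bounded_linear])
  then show ?thesis
    unfolding assign_jacobian_prob_def jacobian_def eq by (simp add: A_def)
qed

lemma (in logit_network) path_costs_has_derivative:
  assumes h: "\<forall>i. 0 \<le> h $ i"
  shows "(path_costs route \<tau> has_derivative (\<lambda>v. path_costs_jacobian route \<tau> h *v v))
           (at h within {h. \<forall>i. 0 \<le> h $ i})"
proof -
  let ?S = "{h :: real^'p. \<forall>i. 0 \<le> h $ i}" and ?D = "incidence route :: real^'p^'l"
  have D_nonneg: "0 \<le> (?D *v x) $ l" if "x \<in> ?S" for x l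
    using that by (auto simp: matrix_vector_mult_def incidence_def intro!: sum_nonneg)
  have D0: "?D $ l $ i = 0" if "l \<notin> arcs G" for l i
    using acyclic_path[of i] that by (auto simp: incidence_def apath_def awalk_def)
  have lin: "((\<lambda>x. (?D *v x) $ l) has_derivative (\<lambda>v. (?D *v v) $ l)) (at h within ?S)" for l
    by (intro bounded_linear_imp_has_derivative bounded_linear_compose[OF bounded_linear_vec_nth]
        matrix_vector_mul_bounded_linear)
  have link: "((\<lambda>x. ?D $ l $ i * \<tau> l ((?D *v x) $ l)) has_derivative
          (\<lambda>v. ?D $ l $ i * (deriv_nonneg (\<tau> l) ((?D *v h) $ l) * (?D *v v) $ l))) (at h within ?S)" for l i
  proof (cases "l \<in> arcs G")
    case True
    have "(\<tau> l has_derivative (\<lambda>v. deriv_nonneg (\<tau> l) ((?D *v h) $ l) * v)) (at ((?D *v h) $ l) within {0..})"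
      using deriv_nonneg_works[OF cost_smooth[OF True] D_nonneg] h
      by (simp add: has_field_derivative_def)
    then have "(\<tau> l has_derivative (\<lambda>v. deriv_nonneg (\<tau> l) ((?D *v h) $ l) * v))
        (at ((?D *v h) $ l) within (\<lambda>x. (?D *v x) $ l) ` ?S)"
      by (rule has_derivative_subset) (use D_nonneg in auto)
    with lin have "((\<lambda>x. \<tau> l ((?D *v x) $ l)) has_derivative
          (\<lambda>v. deriv_nonneg (\<tau> l) ((?D *v h) $ l) * (?D *v v) $ l)) (at h within ?S)"
      by (rule has_derivative_in_compose)
    then show ?thesis by (rule has_derivative_mult_right)
  next
    case False then show ?thesis by (simp add: D0)
  qed
  have jac: "(path_costs_jacobian route \<tau> h *v v) $ i =
      (\<Sum>l\<in>UNIV. ?D $ l $ i * (deriv_nonneg (\<tau> l) ((?D *v h) $ l) * (?D *v v) $ l))" for v i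
  proof -
    have "(link_costs_jacobian \<tau> a *v b) $ l = deriv_nonneg (\<tau> l) (a $ l) * b $ l" for a b l
    proof -
      have "(link_costs_jacobian \<tau> a *v b) $ l
          = (\<Sum>m\<in>UNIV. if m = l then deriv_nonneg (\<tau> l) (a $ l) * b $ m else 0)"
        unfolding link_costs_jacobian_def matrix_vector_mult_def by (simp only: vec_lambda_beta) (rule sum.cong, auto)
      then show ?thesis by simp
    qed
    then show ?thesis
      unfolding path_costs_jacobian_def matrix_vector_mul_assoc[symmetric]
      by (subst matrix_vector_mult_def) (simp add: transpose_def)
  qed
  have cost: "path_costs route \<tau> x $ i = (\<Sum>l\<in>UNIV. ?D $ l $ i * \<tau> l ((?D *v x) $ l))" for x i
    unfolding path_costs_def by (subst matrix_vector_mult_def) (simp add: transpose_def link_costs_def)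
  show ?thesis
  proof (subst has_derivative_componentwise_within, rule ballI)
    fix b :: "real^'p" assume "b \<in> Basis"
    then obtain i where b: "b = axis i 1" by (auto simp: Basis_vec_def)
    show "((\<lambda>x. path_costs route \<tau> x \<bullet> b) has_derivative
        (\<lambda>v. (path_costs_jacobian route \<tau> h *v v) \<bullet> b)) (at h within ?S)"
      unfolding b inner_axis jac cost by (simp add: has_derivative_sum link)
  qed
qed

end

theory Submission
  imports Defs
begin

text \<open>
  The logit Jacobian acts on a cost perturbation \<open>v\<close> by \<open>v\<^sub>i \<mapsto> - \<theta> p\<^sub>i (v\<^sub>i - \<langle>v\<rangle>)\<close>, where \<open>\<langle>v\<rangle>\<close> is the
  \<open>p\<close>-weighted mean of \<open>v\<close> over the OD pair of \<open>i\<close>. If \<open>x = K x\<close>, put \<open>v = C' x\<close>: then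
  \<open>x \<bullet> C' x = - \<theta> \<Sum>\<^sub>i d p\<^sub>i (v\<^sub>i - \<langle>v\<rangle>)\<^sup>2 \<le> 0\<close>, whereas \<open>C'\<close> is positive semidefinite because link costs are
  non-decreasing. So the weighted variance vanishes, hence \<open>x = K x = 0\<close>, and \<open>I - K\<close> is invertible.
  Since \<open>K x\<close> and the residual both sum to zero over every OD pair, so does the solution, and on
  such vectors the additional term of the full Newton matrix vanishes.
\<close>

text \<open>The derivative within \<open>{0..}\<close> is one-sided at zero, so the limit is
  restricted to \<open>at_right x\<close>: this filter is nontrivial for every
  \<open>x \<ge> 0\<close>, and to the right of \<open>x\<close> the difference quotients of a
  non-decreasing function are nonnegative.\<close>

lemma mono_on_deriv_nonneg:
  assumes "twice_cont_diff_nonneg f" "mono_on {0..} f" "0 \<le> x"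
  shows "0 \<le> deriv_nonneg f x"
proof -
  have lim: "((\<lambda>y. (f y - f x) / (y - x)) \<longlongrightarrow> deriv_nonneg f x) (at x within {0..})"
    using deriv_nonneg_works[OF assms(1,3)] by (simp add: has_field_derivative_iff)
  have "at_right x \<le> at x within {0..}"
    using assms(3) by (intro at_le) auto
  then have lim_right: "((\<lambda>y. (f y - f x) / (y - x)) \<longlongrightarrow> deriv_nonneg f x) (at_right x)"
    using lim by (rule tendsto_mono)
  have "\<forall>\<^sub>F y in at_right x. 0 \<le> (f y - f x) / (y - x)"
    unfolding eventually_at_filter
    using assms(2,3) by (intro always_eventually) (auto simp: monotone_on_def)
  then show ?thesis
    using lim_right by (intro tendsto_lowerbound[OF lim_right]) auto
qed

text \<open>The Jacobian has the form \<open>D\<^sup>T diag D\<close> with link cost derivatives on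
  the diagonal, so its quadratic form is a sum of squares of the entries of \<open>D x\<close>
  weighted by these derivatives.\<close>

lemma (in logit_network) path_costs_jacobian_psd:
  assumes "\<forall>i. 0 \<le> h $ i"
  shows "0 \<le> x \<bullet> (path_costs_jacobian route \<tau> h *v x)"
proof -
  let ?D = "incidence route :: real^'p^'l"
  \<comment> \<open>The cost function of a non-arc is unconstrained, so its weight may be negative;
    the square it multiplies must therefore vanish.\<close>
  have D0: "(?D *v x) $ l = 0" if "l \<notin> arcs G" for l
  proof -
    have "l \<notin> set (route i)" for i
      using acyclic_path[of i] that by (auto simp: apath_def awalk_def)
    then show ?thesis by (simp add: incidence_def matrix_vector_mult_def)
  qed
  have flow: "0 \<le> (?D *v h) $ l" for l
    using assms by (auto simp: matrix_vector_mult_def incidence_def intro!: sum_nonneg)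
  have diag: "(link_costs_jacobian \<tau> a *v b) $ l = deriv_nonneg (\<tau> l) (a $ l) * b $ l" for a b l
  proof -
    have "(link_costs_jacobian \<tau> a *v b) $ l
        = (\<Sum>m\<in>UNIV. if m = l then deriv_nonneg (\<tau> l) (a $ l) * b $ m else 0)"
      unfolding link_costs_jacobian_def matrix_vector_mult_def
      by (simp only: vec_lambda_beta) (rule sum.cong, auto)
    then show ?thesis by simp
  qed
  have "x \<bullet> (path_costs_jacobian route \<tau> h *v x)
      = (?D *v x) \<bullet> (link_costs_jacobian \<tau> (?D *v h) *v (?D *v x))"
    unfolding path_costs_jacobian_def matrix_vector_mul_assoc[symmetric]
    by (metis dot_lmul_matrix vector_transpose_matrix)
  also have "\<dots> = (\<Sum>l\<in>UNIV. deriv_nonneg (\<tau> l) ((?D *v h) $ l) * ((?D *v x) $ l)\<^sup>2)"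
    by (simp add: inner_vec_def diag power2_eq_square mult_ac)
  also have "\<dots> \<ge> 0"
  proof (intro sum_nonneg)
    fix l
    show "0 \<le> deriv_nonneg (\<tau> l) ((?D *v h) $ l) * ((?D *v x) $ l)\<^sup>2"
    proof (cases "l \<in> arcs G")
      case True
      then show ?thesis
        using mono_on_deriv_nonneg[OF cost_smooth cost_mono flow] by simp
    qed (simp add: D0)
  qed
  finally show ?thesis .
qed

lemma logit_prob_pos: "0 < logit_prob od \<theta> c $ i"
  unfolding logit_prob_def by (auto intro!: divide_pos_pos sum_pos)

text \<open>Surjectivity gives every OD pair at least one path; for an empty path set the sum would
  be 0.\<close>

lemma logit_prob_sum:
  assumes "surj od"
  shows "(\<Sum>i | od i = w. logit_prob od \<theta> c $ i) = 1"
proof -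
  have "(\<Sum>j | od j = w. exp (- \<theta> * c $ j)) > 0"
    using assms by (intro sum_pos) (auto simp: surj_def, metis)
  moreover have "(\<Sum>i | od i = w. logit_prob od \<theta> c $ i)
      = (\<Sum>i | od i = w. exp (- \<theta> * c $ i) / (\<Sum>j | od j = w. exp (- \<theta> * c $ j)))"
    by (rule sum.cong) (auto simp: logit_prob_def)
  ultimately show ?thesis
    by (simp flip: sum_divide_distrib)
qed

text \<open>This is the quotient rule for softmax, arranged as a deviation from the weighted mean so
  that zero sums and variances can be read off later.\<close>

lemma logit_prob_has_derivative:
  fixes od :: "'p::finite \<Rightarrow> 'w" and \<theta> :: real and c :: "real^'p"
  defines "p \<equiv> logit_prob od \<theta> c"
  shows "(logit_prob od \<theta> has_derivative
    (\<lambda>v. \<chi> i. - \<theta> * p $ i * (v $ i - (\<Sum>j | od j = od i. p $ j * v $ j)))) (at c)"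
proof (subst has_derivative_componentwise_within, rule ballI)
  fix b :: "real^'p" assume "b \<in> Basis"
  then obtain i where b: "b = axis i 1" by (auto simp: Basis_vec_def)
  define S where "S = (\<Sum>j | od j = od i. exp (- \<theta> * c $ j))"
  have S: "S > 0" unfolding S_def by (intro sum_pos) auto
  have nth: "((\<lambda>x. x $ j) has_derivative (\<lambda>v. v $ j)) (at c)" for j :: 'p
    by (intro bounded_linear_imp_has_derivative bounded_linear_vec_nth)
  have e: "((\<lambda>x. exp (- \<theta> * x $ j)) has_derivative (\<lambda>v. exp (- \<theta> * c $ j) * (- \<theta> * v $ j))) (at c)"
    for j :: 'p
    by (rule has_derivative_eq_rhs[OF has_derivative_exp[OF has_derivative_mult_right[OF nth]]])
      (simp add: mult_ac)
  \<comment> \<open>The derivative of the normalizer \<open>S\<close>: within the OD pair of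
    \<open>i\<close> all paths share \<open>S\<close>, so each exponential equals \<open>S\<close>
    times a probability.\<close>
  have mean: "(\<Sum>j | od j = od i. exp (- \<theta> * c $ j) * (- \<theta> * v $ j))
      = - \<theta> * S * (\<Sum>j | od j = od i. p $ j * v $ j)" for v
  proof -
    have "exp (- \<theta> * c $ j) = S * p $ j" if "od j = od i" for j
      using that S by (simp add: p_def logit_prob_def S_def)
    then have "(\<Sum>j | od j = od i. exp (- \<theta> * c $ j) * (- \<theta> * v $ j))
        = (\<Sum>j | od j = od i. - \<theta> * S * (p $ j * v $ j))"
      by (intro sum.cong) auto
    then show ?thesis by (simp only: sum_distrib_left)
  qed
  have "((\<lambda>x. exp (- \<theta> * x $ i) / (\<Sum>j | od j = od i. exp (- \<theta> * x $ j))) has_derivative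
      (\<lambda>v. (exp (- \<theta> * c $ i) * (- \<theta> * v $ i) * S
        - exp (- \<theta> * c $ i) * (\<Sum>j | od j = od i. exp (- \<theta> * c $ j) * (- \<theta> * v $ j))) / (S * S))) (at c)"
    unfolding S_def
    by (rule has_derivative_divide'[OF e has_derivative_sum[OF e]]) (use S in \<open>simp add: S_def\<close>)
  also have "(\<lambda>v. (exp (- \<theta> * c $ i) * (- \<theta> * v $ i) * S
        - exp (- \<theta> * c $ i) * (\<Sum>j | od j = od i. exp (- \<theta> * c $ j) * (- \<theta> * v $ j))) / (S * S))
      = (\<lambda>v. - \<theta> * p $ i * (v $ i - (\<Sum>j | od j = od i. p $ j * v $ j)))"
  proof
    fix v :: "real^'p"
    have "exp (- \<theta> * c $ i) = S * p $ i"
      using S by (simp add: p_def logit_prob_def S_def)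
    then show "(exp (- \<theta> * c $ i) * (- \<theta> * v $ i) * S
        - exp (- \<theta> * c $ i) * (\<Sum>j | od j = od i. exp (- \<theta> * c $ j) * (- \<theta> * v $ j))) / (S * S)
      = - \<theta> * p $ i * (v $ i - (\<Sum>j | od j = od i. p $ j * v $ j))"
      unfolding mean using S by (simp add: field_simps)
  qed
  finally show "((\<lambda>x. logit_prob od \<theta> x \<bullet> b) has_derivative
      (\<lambda>v. (\<chi> i. - \<theta> * p $ i * (v $ i - (\<Sum>j | od j = od i. p $ j * v $ j))) \<bullet> b)) (at c)"
    unfolding b inner_axis logit_prob_def by simp
qed

lemma reduced_jacobian_mult:
  fixes od :: "'p::finite \<Rightarrow> 'w" and route :: "'p \<Rightarrow> 'l::finite list"
    and \<tau> :: "'l \<Rightarrow> real \<Rightarrow> real" and \<theta> :: real and h x :: "real^'p"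
  assumes "h \<in> feasible_flows od d"
  defines "p \<equiv> path_probs od route \<tau> \<theta> h" and "v \<equiv> path_costs_jacobian route \<tau> h *v x"
  shows "(reduced_jacobian od route \<tau> \<theta> h *v x) $ i
    = - \<theta> * (d (od i) * p $ i * (v $ i - (\<Sum>j | od j = od i. p $ j * v $ j)))"
proof -
  let ?J = "jacobian (logit_prob od \<theta>) (at (path_costs route \<tau> h))"
  note der = logit_prob_has_derivative[of od \<theta> "path_costs route \<tau> h"]
  have "(logit_prob od \<theta> has_derivative (\<lambda>v. ?J *v v)) (at (path_costs route \<tau> h))"
    by (rule jacobian_works[THEN iffD1, OF differentiableI[OF der]])
  \<comment> \<open>The abstract \<open>jacobian\<close> and the explicit softmax formula both
    represent the derivative at the same point, hence agree as linear maps.\<close>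
  from has_derivative_unique[OF this der]
  have J: "?J *v v = (\<chi> i. - \<theta> * p $ i * (v $ i - (\<Sum>j | od j = od i. p $ j * v $ j)))"
    by (simp add: fun_eq_iff p_def path_probs_def)
  have H: "(assign_jacobian_prob od h p *v u) $ i = d (od i) * u $ i" for u
  proof -
    have "(assign_jacobian_prob od h p *v u) $ i = (\<Sum>j\<in>UNIV. if j = i then d (od i) * u $ j else 0)"
      unfolding matrix_vector_mult_def
      by (simp only: vec_lambda_beta assign_jacobian_prob_entry[OF assms(1)]) (rule sum.cong, auto)
    then show ?thesis by simp
  qed
  have "(reduced_jacobian od route \<tau> \<theta> h *v x) $ i = (assign_jacobian_prob od h p *v (?J *v v)) $ i"
    by (simp add: reduced_jacobian_def p_def v_def matrix_vector_mul_assoc[symmetric])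
  then show ?thesis by (simp add: H J)
qed

lemma sum_deviation_from_weighted_mean:
  fixes p v :: "'p \<Rightarrow> real"
  assumes "(\<Sum>i\<in>A. p i) = 1"
  shows "(\<Sum>i\<in>A. p i * (v i - (\<Sum>j\<in>A. p j * v j))) = 0"
  unfolding right_diff_distrib sum_subtractf sum_distrib_right[symmetric] assms by simp

text \<open>Replacing the factor \<open>v i\<close> by \<open>v i - a (od i)\<close> costs nothing:
  \<open>d\<close> and \<open>a\<close> are constant on each OD pair, and there the weighted
  deviations sum to zero.\<close>

lemma weighted_covariance_eq_variance:
  fixes od :: "'p::finite \<Rightarrow> 'w::finite" and p v :: "'p \<Rightarrow> real" and d :: "'w \<Rightarrow> real"
  assumes "\<And>w. (\<Sum>i | od i = w. p i) = 1"
  defines "a \<equiv> \<lambda>w. \<Sum>j | od j = w. p j * v j"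
  shows "(\<Sum>i\<in>UNIV. d (od i) * p i * (v i - a (od i)) * v i)
    = (\<Sum>i\<in>UNIV. d (od i) * p i * (v i - a (od i))\<^sup>2)"
proof -
  have "(\<Sum>i\<in>UNIV. d (od i) * p i * (v i - a (od i)) * a (od i))
      = (\<Sum>w\<in>UNIV. \<Sum>i | od i = w. d (od i) * p i * (v i - a (od i)) * a (od i))"
    using sum.group[of UNIV UNIV od "\<lambda>i. d (od i) * p i * (v i - a (od i)) * a (od i)"] by simp
  also have "\<dots> = (\<Sum>w\<in>UNIV. d w * a w * (\<Sum>i | od i = w. p i * (v i - a w)))"
    unfolding sum_distrib_left by (intro sum.cong) (auto simp: mult_ac)
  also have "\<dots> = 0"
    using sum_deviation_from_weighted_mean[OF assms(1)] by (simp add: a_def)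
  finally have "(\<Sum>i\<in>UNIV. d (od i) * p i * (v i - a (od i)) * v i)
      = (\<Sum>i\<in>UNIV. d (od i) * p i * (v i - a (od i)) * v i - d (od i) * p i * (v i - a (od i)) * a (od i))"
    by (simp add: sum_subtractf)
  also have "\<dots> = (\<Sum>i\<in>UNIV. d (od i) * p i * (v i - a (od i))\<^sup>2)"
    by (intro sum.cong) (auto simp: power2_eq_square algebra_simps)
  finally show ?thesis .
qed

text \<open>On each OD pair the image is a constant multiple of the weighted deviations from their
  mean.\<close>

lemma (in logit_network) reduced_jacobian_sum_zero:
  assumes "h \<in> feasible_flows od d"
  shows "(\<Sum>i | od i = w. (reduced_jacobian od route \<tau> \<theta> h *v x) $ i) = 0"
proof -
  define p where "p = path_probs od route \<tau> \<theta> h"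
  define v where "v = path_costs_jacobian route \<tau> h *v x"
  have "(\<Sum>i | od i = w. (reduced_jacobian od route \<tau> \<theta> h *v x) $ i)
      = (\<Sum>i | od i = w. - \<theta> * d w * (p $ i * (v $ i - (\<Sum>j | od j = w. p $ j * v $ j))))"
    unfolding reduced_jacobian_mult[OF assms] p_def v_def by (intro sum.cong) auto
  also have "\<dots> = - \<theta> * d w * (\<Sum>i | od i = w. p $ i * (v $ i - (\<Sum>j | od j = w. p $ j * v $ j)))"
    by (simp only: sum_distrib_left)
  finally show ?thesis
    using logit_prob_sum[OF surj_od]
    by (simp add: sum_deviation_from_weighted_mean p_def path_probs_def)
qed

text \<open>The logit flow and \<open>h\<close> itself carry the same demand
  \<open>d w\<close>.\<close>

lemma (in logit_network) residual_sum_zero: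
  assumes "h \<in> feasible_flows od d"
  shows "(\<Sum>i | od i = w. residual od route \<tau> \<theta> h $ i) = 0"
proof -
  have "(\<Sum>i | od i = w. residual od route \<tau> \<theta> h $ i)
      = d w * (\<Sum>i | od i = w. path_probs od route \<tau> \<theta> h $ i) - (\<Sum>i | od i = w. h $ i)"
    using assms unfolding sum_distrib_left sum_subtractf[symmetric]
    by (intro sum.cong) (auto simp: residual_def logit_map_def assign_flow_def feasible_flows_def)
  then show ?thesis
    using assms logit_prob_sum[OF surj_od] by (simp add: path_probs_def feasible_flows_def)
qed

lemma (in logit_network) reduced_jacobian_fixed_point_zero:
  assumes h: "h \<in> feasible_flows od d" and fix_x: "reduced_jacobian od route \<tau> \<theta> h *v x = x"
  shows "x = 0"
proof -
  define p where "p = path_probs od route \<tau> \<theta> h"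
  define v where "v = path_costs_jacobian route \<tau> h *v x"
  define u where "u i = v $ i - (\<Sum>j | od j = od i. p $ j * v $ j)" for i
  have x: "x $ i = - \<theta> * (d (od i) * p $ i * u i)" for i
    using reduced_jacobian_mult[OF h, of route \<tau> \<theta> x i] unfolding fix_x p_def v_def u_def .
  have p_pos: "p $ i > 0" for i
    unfolding p_def path_probs_def by (rule logit_prob_pos)
  have p_sum: "(\<Sum>i | od i = w. p $ i) = 1" for w
    unfolding p_def path_probs_def by (rule logit_prob_sum[OF surj_od])
  have "x \<bullet> v = - \<theta> * (\<Sum>i\<in>UNIV. d (od i) * p $ i * u i * v $ i)"
    by (simp add: inner_vec_def x sum_distrib_left sum_negf mult_ac)
  also have "(\<Sum>i\<in>UNIV. d (od i) * p $ i * u i * v $ i) = (\<Sum>i\<in>UNIV. d (od i) * p $ i * (u i)\<^sup>2)"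
    unfolding u_def by (rule weighted_covariance_eq_variance[OF p_sum])
  finally have "x \<bullet> v = - \<theta> * (\<Sum>i\<in>UNIV. d (od i) * p $ i * (u i)\<^sup>2)" .
  moreover have "0 \<le> x \<bullet> v"
    unfolding v_def using h by (intro path_costs_jacobian_psd) (auto simp: feasible_flows_def)
  ultimately have "(\<Sum>i\<in>UNIV. d (od i) * p $ i * (u i)\<^sup>2) \<le> 0"
    using theta_pos by (simp add: mult_le_0_iff)
  moreover have nonneg: "0 \<le> d (od i) * p $ i * (u i)\<^sup>2" for i
    using demand_nonneg less_imp_le[OF p_pos] by simp
  ultimately have "(\<Sum>i\<in>UNIV. d (od i) * p $ i * (u i)\<^sup>2) = 0"
    by (intro antisym sum_nonneg) auto
  then have "d (od i) * p $ i * (u i)\<^sup>2 = 0" for i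
    using nonneg by (simp add: sum_nonneg_eq_0_iff)
  \<comment> \<open>The deviation \<open>u i\<close> need not vanish where demand is zero, but
    \<open>x $ i\<close> contains the factor \<open>d (od i)\<close> as well as \<open>u i\<close>,
    so it is zero in either case.\<close>
  then show ?thesis by (auto simp: vec_eq_iff x)
qed

theorem theorem5:
  fixes G :: "('v, 'l::finite) pre_digraph"
    and origin dest :: "'w::finite \<Rightarrow> 'v"
    and od :: "'p::finite \<Rightarrow> 'w"
    and route :: "'p \<Rightarrow> 'l list"
    and d :: "'w \<Rightarrow> real"
    and \<tau> :: "'l \<Rightarrow> real \<Rightarrow> real"
    and \<theta> :: real
    and h :: "real^'p"
  assumes "logit_network G origin dest od route d \<tau> \<theta>"
    and "h \<in> feasible_flows od d"
  shows "\<exists>\<delta> :: real^'p.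
      {x. (mat 1 - reduced_jacobian od route \<tau> \<theta> h) *v x = residual od route \<tau> \<theta> h} = {\<delta>} \<and>
      {x. (assign_jacobian_flow od h (path_probs od route \<tau> \<theta> h)
             + reduced_jacobian od route \<tau> \<theta> h - mat 1) *v x = - residual od route \<tau> \<theta> h \<and>
          (\<forall>w. (\<Sum>i | od i = w. x $ i) = 0)} = {\<delta>}"
proof -
  interpret logit_network G origin dest od route d \<tau> \<theta> by (rule assms(1))
  note h = assms(2)
  let ?K = "reduced_jacobian od route \<tau> \<theta> h" and ?F = "residual od route \<tau> \<theta> h"
  let ?H = "assign_jacobian_flow od h (path_probs od route \<tau> \<theta> h)"
  \<comment> \<open>Only the OD totals of \<open>x\<close> enter, so this matrix annihilates every
    vector whose totals are zero.\<close>
  have H: "(?H *v x) $ i = path_probs od route \<tau> \<theta> h $ i * (\<Sum>j | od j = od i. x $ j)" for x i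
  proof -
    have "(?H *v x) $ i
        = (\<Sum>j\<in>UNIV. if od j = od i then path_probs od route \<tau> \<theta> h $ i * x $ j else 0)"
      unfolding matrix_vector_mult_def
      by (simp only: vec_lambda_beta assign_jacobian_flow_entry) (rule sum.cong, auto)
    then show ?thesis by (simp add: sum_distrib_left flip: sum.inter_filter)
  qed
  have "inj ((*v) (mat 1 - ?K))"
    unfolding vec.inj_iff_eq_0
  proof (intro allI impI)
    fix x :: "real^'p" assume "(mat 1 - ?K) *v x = 0"
    then show "x = 0"
      by (intro reduced_jacobian_fixed_point_zero[OF h]) (simp add: matrix_vector_mult_diff_rdistrib)
  qed
  \<comment> \<open>An injective linear endomorphism of a finite-dimensional space is surjective,
    which supplies existence.\<close>
  then have "bij ((*v) (mat 1 - ?K))"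
    by (simp add: bij_def linear_injective_imp_surjective)
  then obtain \<delta> where "\<And>x. (mat 1 - ?K) *v x = ?F \<longleftrightarrow> x = \<delta>"
    unfolding bij_iff by metis
  then have \<delta>: "{x. (mat 1 - ?K) *v x = ?F} = {\<delta>}"
    by blast
  \<comment> \<open>With this equivalence the demand-preserving solutions of the full system are
    exactly the solutions of the reduced one, so both sets are the same singleton.\<close>
  have "((?H + ?K - mat 1) *v x = - ?F \<and> (\<forall>w. (\<Sum>i | od i = w. x $ i) = 0))
      \<longleftrightarrow> (mat 1 - ?K) *v x = ?F" for x
  proof -
    have "(\<Sum>i | od i = w. x $ i) = 0" if "(mat 1 - ?K) *v x = ?F" for w
    proof -
      have "x $ i = (?K *v x) $ i + ?F $ i" for i
        unfolding that[symmetric] by (simp add: matrix_vector_mult_diff_rdistrib)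
      then have "(\<Sum>i | od i = w. x $ i) = (\<Sum>i | od i = w. (?K *v x) $ i + ?F $ i)"
        by (rule sum.cong[OF refl])
      then show ?thesis
        by (simp add: sum.distrib reduced_jacobian_sum_zero[OF h] residual_sum_zero[OF h])
    qed
    moreover have "(?H + ?K - mat 1) *v x = - ((mat 1 - ?K) *v x)"
      if "\<forall>w. (\<Sum>i | od i = w. x $ i) = 0"
    proof -
      have "?H *v x = 0" using that by (simp add: vec_eq_iff H)
      then show ?thesis
        by (simp add: matrix_vector_mult_diff_rdistrib matrix_vector_mult_add_rdistrib)
    qed
    ultimately show ?thesis by (metis neg_equal_iff_equal)
  qed
  with \<delta> show ?thesis by auto
qed

end
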